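(* Let $n\geq k\geq 3$ be integers and let $A\in M_n(\mathbb{R})$ be a $k$-positive (symmetric) matrix. Then $S_k(\mathrm{diag}(A))\geq S_k(A)$. Moreover, equality holds if and only if $A$ is diagonal.
   Context: $M_n(\mathbb{R})$ is the set of $n\times n$ real matrices. For $\lambda=(\lambda_1,\dots,\lambda_n)\in\mathbb{R}^n$ and $1\le j\le n$, $S_j(\lambda)=\sum_{1\leq i_1<\cdots<i_j\leq n}\lambda_{i_1}\cdots\lambda_{i_j}$ is the $j$-th elementary symmetric function. $\Gamma_k(n)=\{\lambda\in\mathbb{R}^n : S_j(\lambda)>0 \text{ for all } j=1,\dots,k\}$. For a symmetric matrix $A\in M_n(\mathbb{R})$, $\lambda(A)=(\lambda_1,\dots,\lambda_n)$ denotes its eigenvalues (with multiplicity) and $S_k(A):=S_k(\lambda(A))$. A matrix $A\in M_n(\mathbb{R})$ is called $k$-positive if it is symmetric and $\lambda(A)\in\Gamma_k(n)$. For $A=(a_{ij})$, $\mathrm{diag}(A)$ is the diagonal matrix $\mathrm{diag}(a_{11},\dots,a_{nn})$. *)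

theory Defs
  imports Complex_Main "HOL-Library.Multiset" "HOL-Computational_Algebra.Polynomial"
    "Jordan_Normal_Form.Char_Poly"
begin

text \<open>A vector \<open>(\<lambda>\<^sub>1, \<dots>, \<lambda>\<^sub>n)\<close> is an element of \<open>carrier_vec n\<close>, with indices \<open>0, \<dots>, n - 1\<close>.
  An increasing tuple \<open>i\<^sub>1 < \<dots> < i\<^sub>j\<close> is represented by the set of its entries.\<close>

definition elem_sym :: "nat \<Rightarrow> real vec \<Rightarrow> real" where
  "elem_sym j v = (\<Sum>I | I \<subseteq> {0..<dim_vec v} \<and> card I = j. \<Prod>i\<in>I. v $ i)"

definition Gamma_cone :: "nat \<Rightarrow> nat \<Rightarrow> real vec set" where
  "Gamma_cone k n = {v \<in> carrier_vec n. \<forall>j\<in>{1..k}. elem_sym j v > 0}"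

text \<open>The real eigenvalues with algebraic multiplicity, in nondecreasing order. Only used for
  symmetric matrices, where the characteristic polynomial splits over the reals, so that
  an \<open>n \<times> n\<close> matrix yields a vector of dimension \<open>n\<close>. The choice of order is immaterial, as only
  symmetric functions of the eigenvalues occur.\<close>

definition eigenvalue_vec :: "real mat \<Rightarrow> real vec" where
  "eigenvalue_vec A = vec_of_list (sorted_list_of_multiset (proots (char_poly A)))"

definition mat_elem_sym :: "nat \<Rightarrow> real mat \<Rightarrow> real" where
  "mat_elem_sym k A = elem_sym k (eigenvalue_vec A)"

definition k_positive :: "nat \<Rightarrow> nat \<Rightarrow> real mat \<Rightarrow> bool" where
  "k_positive n k A \<longleftrightarrow>
     A \<in> carrier_mat n n \<and> transpose_mat A = A \<and> eigenvalue_vec A \<in> Gamma_cone k n"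

definition diag_part :: "real mat \<Rightarrow> real mat" where
  "diag_part A = mat_diag (dim_row A) (\<lambda>i. A $$ (i, i))"

end

theory Submission
  imports Defs "Jordan_Normal_Form.Spectral_Radius"
begin

text \<open>With \<open>E\<^sub>A(x) = det (1 + x A)\<close>, the number \<open>S\<^sub>k(A)\<close> is the coefficient of \<open>x\<^sup>k\<close> in \<open>E\<^sub>A\<close>.
  Write \<open>A\<close> as a bordered matrix with upper left block \<open>B\<close>, last column \<open>b\<close> and corner \<open>a\<close>,
  and let \<open>\<mu>\<close> be the eigenvalues of \<open>B\<close> and \<open>c\<close> the coordinates of \<open>b\<close> in an eigenbasis. Then
  \<open>E\<^sub>A(x) = (1 + a x) E\<^sub>B(x) - x\<^sup>2 (\<Sum>l. c\<^sub>l\<^sup>2 (\<Prod>i\<noteq>l. 1 + \<mu>\<^sub>i x))\<close>, so deleting \<open>b\<close> raises \<open>S\<^sub>k\<close>, and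
  strictly so unless \<open>b = 0\<close>, as long as the numbers \<open>S\<^sub>j(\<mu> | l)\<close> with \<open>j \<le> k - 2\<close> are positive.
  They are: Newton's inequality shows that deleting an entry maps \<open>\<Gamma>\<^sub>k\<close> into \<open>\<Gamma>\<^sub>k\<^sub>-\<^sub>1\<close>, and
  \<open>E\<^sub>B\<close> is a convex combination of the polynomials \<open>\<Prod>i\<noteq>l. 1 + \<lambda>\<^sub>i x\<close>, where \<open>\<lambda>\<close> are the
  eigenvalues of \<open>A\<close>. Deleting the off-diagonal entries one border at a time leaves \<open>diag(A)\<close>.\<close>

section \<open>Real-rooted polynomials and Newton's inequality\<close>

interpretation of_real_poly: map_poly_inj_idom_hom "of_real :: real \<Rightarrow> complex" ..

text \<open>Tested on the complexification, which makes products immediate. The zero polynomial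
  fails the test, hence the side condition in \<open>real_rooted_pderiv\<close>.\<close>

definition real_rooted :: "real poly \<Rightarrow> bool" where
  "real_rooted p \<longleftrightarrow> (\<forall>z. Im z \<noteq> 0 \<longrightarrow> poly (map_poly complex_of_real p) z \<noteq> 0)"

lemma real_rooted_mult:
  assumes "real_rooted p" "real_rooted q"
  shows "real_rooted (p * q)"
  using assms by (simp add: real_rooted_def of_real_poly.hom_mult)

lemma real_rooted_linear: "real_rooted [:1, t:]"
  by (auto simp: real_rooted_def of_real_hom.map_poly_pCons_hom complex_eq_iff)

lemma real_rooted_1: "real_rooted 1"
  by (simp add: real_rooted_def)

lemma real_rooted_prod:
  assumes "\<And>i. i \<in> I \<Longrightarrow> real_rooted (f i)"
  shows "real_rooted (\<Prod>i\<in>I. f i)"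
  using assms by (induction I rule: infinite_finite_induct)
    (auto intro: real_rooted_1 real_rooted_mult)

lemma map_poly_of_real_linear_factors:
  "map_poly complex_of_real (\<Prod>r\<leftarrow>rs. [:- r, 1:]) = (\<Prod>r\<leftarrow>rs. [:- of_real r, 1:])"
proof (induction rs)
  case (Cons r rs)
  have "map_poly complex_of_real [:- r, 1:] = [:- of_real r, 1:]"
    by (simp add: of_real_hom.map_poly_pCons_hom)
  with Cons show ?case
    by (simp only: list.map prod_list.Cons of_real_poly.hom_mult)
qed simp

text \<open>Over the complex numbers \<open>p\<close> splits, its roots are real by assumption, and
  injectivity of \<open>map_poly of_real\<close> carries the factorisation back to the
  reals.\<close>

lemma real_rooted_factor:
  assumes "real_rooted p"
  obtains rs where "p = Polynomial.smult (lead_coeff p) (\<Prod>r\<leftarrow>rs. [:- r, 1:])"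
proof -
  let ?q = "map_poly complex_of_real p"
  obtain zs where zs: "Polynomial.smult (lead_coeff ?q) (\<Prod>z\<leftarrow>zs. [:- z, 1:]) = ?q"
    using fundamental_theorem_algebra_factorized[of ?q] by blast
  have "Im z = 0" if "z \<in> set zs" for z
  proof (rule ccontr)
    assume "Im z \<noteq> 0"
    moreover have "poly ?q z = 0"
      using that by (subst zs[symmetric]) (simp add: poly_prod_list_zero_iff)
    ultimately show False
      using assms by (simp add: real_rooted_def)
  qed
  then have "map of_real (map Re zs) = zs"
    by (auto intro!: map_idI simp: complex_eq_iff)
  then have "map_poly of_real (\<Prod>r\<leftarrow>map Re zs. [:- r, 1:]) = (\<Prod>z\<leftarrow>zs. [:- z, 1:])"
    unfolding map_poly_of_real_linear_factors
    by (metis (no_types, lifting) list.map_comp o_def map_eq_conv)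
  then have "map_poly of_real (Polynomial.smult (lead_coeff p) (\<Prod>r\<leftarrow>map Re zs. [:- r, 1:])) = ?q"
    using zs by (simp add: of_real_hom.map_poly_hom_smult)
  then have "Polynomial.smult (lead_coeff p) (\<Prod>r\<leftarrow>map Re zs. [:- r, 1:]) = p"
    by (rule of_real_poly.injectivity)
  then show thesis
    using that by metis
qed

text \<open>The logarithmic derivative \<open>\<Sum>r. 1 / (z - r)\<close> maps the upper half-plane to the lower one
  and vice versa.\<close>

lemma Im_log_deriv:
  fixes z :: complex
  assumes "rs \<noteq> []" and "Im z \<noteq> 0"
  defines "q \<equiv> \<Prod>r\<leftarrow>rs. [:- complex_of_real r, 1:]"
  shows "Im z * Im (poly (pderiv q) z / poly q z) < 0"
proof -
  define f where "f rs = (\<Prod>r\<leftarrow>rs. [:- complex_of_real r, 1:])" for rs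
  have nz: "poly (f rs) z \<noteq> 0" for rs
    using assms(2) by (auto simp: f_def poly_prod_list_zero_iff)
  have log_deriv_Cons: "poly (pderiv (f (r # rs))) z / poly (f (r # rs)) z
      = inverse (z - of_real r) + poly (pderiv (f rs)) z / poly (f rs) z" for r rs
  proof -
    have "z \<noteq> of_real r" using assms(2) by auto
    moreover have "f (r # rs) = [:- of_real r, 1:] * f rs" by (simp add: f_def)
    ultimately show ?thesis
      using nz[of rs] by (simp only: pderiv_mult poly_mult poly_add) (simp add: pderiv_pCons field_simps)
  qed
  have neg: "Im z * Im (inverse (z - of_real r)) < 0" for r
  proof -
    have "Im z * Im (inverse (z - of_real r)) = - ((Im z)\<^sup>2 / ((Re z - r)\<^sup>2 + (Im z)\<^sup>2))"
      by (simp add: power2_eq_square)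
    moreover have "(Im z)\<^sup>2 / ((Re z - r)\<^sup>2 + (Im z)\<^sup>2) > 0"
      using assms(2) by (intro divide_pos_pos add_nonneg_pos) auto
    ultimately show ?thesis by linarith
  qed
  \<comment> \<open>The induction starts from the empty list, where the quotient is 0, so it gives a
    weak inequality only; splitting off one root afterwards makes it strict.\<close>
  have "Im z * Im (poly (pderiv (f rs)) z / poly (f rs) z) \<le> 0" for rs
  proof (induction rs)
    case Nil
    then show ?case by (simp add: f_def)
  next
    case (Cons r rs)
    then show ?case
      using neg[of r] by (simp only: log_deriv_Cons plus_complex.sel distrib_left)
  qed
  moreover obtain r rs' where "rs = r # rs'"
    using assms(1) by (cases rs) auto
  ultimately have "Im z * Im (poly (pderiv (f rs)) z / poly (f rs) z) < 0"
    using neg[of r] by (simp only: log_deriv_Cons plus_complex.sel distrib_left) (smt (verit))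
  then show ?thesis by (simp add: f_def q_def)
qed

text \<open>A nonreal zero of the derivative would be a zero of the logarithmic derivative, whose
  imaginary part is nonzero there by \<open>Im_log_deriv\<close>.\<close>

lemma real_rooted_pderiv:
  assumes "real_rooted p" and "pderiv p \<noteq> 0"
  shows "real_rooted (pderiv p)"
proof -
  obtain rs where p: "p = Polynomial.smult (lead_coeff p) (\<Prod>r\<leftarrow>rs. [:- r, 1:])"
    using real_rooted_factor[OF assms(1)] by blast
  let ?q = "\<Prod>r\<leftarrow>rs. [:- complex_of_real r, 1:]"
  have rs: "rs \<noteq> []"
    using assms(2) by (subst (asm) p) (auto simp: pderiv_smult)
  have lc: "lead_coeff p \<noteq> 0"
    using assms(2) by auto
  have "map_poly of_real p = Polynomial.smult (of_real (lead_coeff p)) ?q"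
    by (subst p) (simp only: of_real_hom.map_poly_hom_smult map_poly_of_real_linear_factors)
  then have eq: "map_poly of_real (pderiv p) = Polynomial.smult (of_real (lead_coeff p)) (pderiv ?q)"
    by (simp add: of_real_hom.map_poly_pderiv pderiv_smult)
  show ?thesis
    unfolding real_rooted_def
  proof (intro allI impI)
    fix z :: complex assume "Im z \<noteq> 0"
    from Im_log_deriv[OF rs this] show "poly (map_poly of_real (pderiv p)) z \<noteq> 0"
      using lc by (auto simp: eq)
  qed
qed

lemma real_rooted_newton_0:
  assumes "real_rooted p"
  shows "2 * coeff p 0 * coeff p 2 \<le> (coeff p 1)\<^sup>2"
proof -
  obtain rs where p: "p = Polynomial.smult (lead_coeff p) (\<Prod>r\<leftarrow>rs. [:- r, 1:])"
    using real_rooted_factor[OF assms] by blast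
  have *: "2 * coeff q 0 * coeff q 2 \<le> (coeff q 1)\<^sup>2" if "q = (\<Prod>r\<leftarrow>rs. [:- r, 1:])" for q
    using that
  proof (induction rs arbitrary: q)
    case Nil
    then show ?case by simp
  next
    case (Cons r rs)
    define g where "g = (\<Prod>r\<leftarrow>rs. [:- r, 1:])"
    have q: "q = pCons 0 g - Polynomial.smult r g" using Cons.prems by (simp add: g_def)
    have c: "coeff q 0 = - r * coeff g 0" "coeff q 1 = coeff g 0 - r * coeff g 1"
      "coeff q 2 = coeff g 1 - r * coeff g 2"
      by (simp_all add: q coeff_pCons numeral_2_eq_2)
    have "r\<^sup>2 * (2 * coeff g 0 * coeff g 2) \<le> r\<^sup>2 * (coeff g 1)\<^sup>2"
      using Cons.IH[OF g_def] by (rule mult_left_mono) simp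
    \<comment> \<open>Multiplying \<open>g\<close> by \<open>x - r\<close> turns the defect
      \<open>D = g1^2 - 2 g0 g2\<close> into \<open>g0^2 + r^2 D\<close>, so nonnegativity is
      inherited.\<close>
    moreover have "(coeff q 1)\<^sup>2 - 2 * coeff q 0 * coeff q 2
        = (coeff g 0)\<^sup>2 + (r\<^sup>2 * (coeff g 1)\<^sup>2 - r\<^sup>2 * (2 * coeff g 0 * coeff g 2))"
      unfolding c by (simp add: algebra_simps power2_eq_square)
    ultimately show ?case
      by (smt (verit) zero_le_power2)
  qed
  let ?q = "\<Prod>r\<leftarrow>rs. [:- r, 1:]"
  have c: "coeff p i = lead_coeff p * coeff ?q i" for i
    by (subst p) simp
  have "(lead_coeff p)\<^sup>2 * (2 * coeff ?q 0 * coeff ?q 2) \<le> (lead_coeff p)\<^sup>2 * (coeff ?q 1)\<^sup>2"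
    using *[OF refl] by (rule mult_left_mono) simp
  then show ?thesis
    by (subst (1 2 3) c) (simp add: power_mult_distrib power2_eq_square ac_simps)
qed

text \<open>Differentiation preserves real-rootedness and shifts coefficients down, so
  \<open>j\<close> derivatives reduce the claim to the three lowest coefficients. The weights come
  from \<open>coeff_pderiv\<close>.\<close>

lemma real_rooted_newton:
  assumes "real_rooted p"
  shows "real (j + 2) * coeff p j * coeff p (j + 2) \<le> real (j + 1) * (coeff p (j + 1))\<^sup>2"
  using assms
proof (induction j arbitrary: p)
  case 0
  then show ?case using real_rooted_newton_0[of p] by (simp add: numeral_2_eq_2)
next
  case (Suc j)
  show ?case
  \<comment> \<open>A zero derivative is not \<open>real_rooted\<close>, so the induction hypothesis
    cannot be applied to it; the left-hand side then vanishes.\<close>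
  proof (cases "pderiv p = 0")
    case True
    then have "degree p = 0" by (simp add: pderiv_eq_0_iff)
    then have "coeff p (Suc j) = 0" by (simp add: coeff_eq_0)
    then show ?thesis by simp
  next
    case False
    define m where "m = real j + 1"
    have m: "m > 0" by (simp add: m_def)
    from Suc.IH[OF real_rooted_pderiv[OF Suc.prems False]]
    have "(m + 1) * (m * coeff p (j + 1)) * ((m + 2) * coeff p (j + 3))
        \<le> m * ((m + 1) * coeff p (j + 2))\<^sup>2"
      by (simp add: coeff_pderiv m_def numeral_3_eq_3 numeral_2_eq_2 add_ac)
    then have "(m * (m + 1)) * ((m + 2) * coeff p (j + 1) * coeff p (j + 3))
        \<le> (m * (m + 1)) * ((m + 1) * (coeff p (j + 2))\<^sup>2)"
      by (simp add: power_mult_distrib power2_eq_square ac_simps)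
    then have "(m + 2) * coeff p (j + 1) * coeff p (j + 3) \<le> (m + 1) * (coeff p (j + 2))\<^sup>2"
      using m by (simp add: mult_le_cancel_left)
    then show ?thesis
      by (simp add: m_def numeral_3_eq_3 numeral_2_eq_2 add_ac)
  qed
qed

lemma real_rooted_newton_weak:
  assumes "real_rooted p"
  shows "coeff p j * coeff p (j + 2) \<le> (coeff p (j + 1))\<^sup>2"
proof (cases "coeff p j * coeff p (j + 2) \<le> 0")
  case True
  then show ?thesis by (smt (verit) zero_le_power2)
next
  case False
  have "real (j + 1) * (coeff p j * coeff p (j + 2)) \<le> real (j + 2) * (coeff p j * coeff p (j + 2))"
    using False by (intro mult_right_mono) auto
  also have "\<dots> \<le> real (j + 1) * (coeff p (j + 1))\<^sup>2"
    using real_rooted_newton[OF assms, of j] by (simp add: mult.assoc)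
  finally show ?thesis by (simp add: mult_le_cancel_left del: of_nat_add)
qed

text \<open>Polynomial form of deleting the entry \<open>t\<close> from a vector in the cone.
  Positivity climbs one degree at a time by Newton's inequality.\<close>

lemma pos_coeffs_remove_factor:
  assumes q: "real_rooted q" and q0: "coeff q 0 > 0"
    and pos: "\<And>j. j \<le> Suc k \<Longrightarrow> coeff ([:1, t:] * q) j > 0"
    and "j \<le> k"
  shows "coeff q j > 0"
  using \<open>j \<le> k\<close>
proof (induction j)
  case 0
  then show ?case using q0 by simp
next
  case (Suc j)
  define a b c where "a = coeff q j" "b = coeff q (Suc j)" "c = coeff q (Suc (Suc j))"
  have a: "a > 0" using Suc by (simp add: a_b_c_def)
  have "b + t * a > 0" "c + t * b > 0"
    using pos[of "Suc j"] pos[of "Suc (Suc j)"] Suc.prems by (simp_all add: a_b_c_def)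
  moreover have "a * c \<le> b\<^sup>2"
    using real_rooted_newton_weak[OF q, of j] by (simp add: a_b_c_def)
  \<comment> \<open>With \<open>b <= 0 < a\<close> the two positive sums give
    \<open>a * c > - t * a * b >= b^2\<close>, against Newton.\<close>
  moreover have False if "b \<le> 0" "b + t * a > 0" "c + t * b > 0" "a * c \<le> b\<^sup>2"
  proof -
    have "a * (c + t * b) > 0" using a that by simp
    moreover have "b * (b + t * a) \<le> 0" using that by (simp add: mult_nonpos_nonneg)
    ultimately show False using that(4) by (simp add: algebra_simps power2_eq_square)
  qed
  ultimately show ?case
    unfolding a_b_c_def[symmetric] by fastforce
qed

section \<open>Orthogonal diagonalisation\<close>

text \<open>At a complex eigenvector the Hermitian form of \<open>A\<close> is real and also equals
  \<open>z\<close> times the nonzero real number \<open>t\<close>; hence \<open>z\<close> is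
  real.\<close>

lemma symmetric_real_eigenvalue:
  fixes A :: "real mat"
  assumes A: "A \<in> carrier_mat n n" and sym: "transpose_mat A = A" and n: "n > 0"
  obtains e where "eigenvalue A e"
proof -
  let ?A = "map_mat complex_of_real A"
  have A': "?A \<in> carrier_mat n n" using A by simp
  obtain z where z: "eigenvalue ?A z"
    using spectrum_non_empty[OF A' n] by (auto simp: spectrum_def)
  then obtain v where v: "v \<in> carrier_vec n" "v \<noteq> 0\<^sub>v n" "?A *\<^sub>v v = z \<cdot>\<^sub>v v"
    using A by (auto simp: eigenvalue_def eigenvector_def)
  define S where "S = (\<Sum>i<n. \<Sum>j<n. cnj (v $ i) * of_real (A $$ (i, j)) * v $ j)"
  define t where "t = (\<Sum>i<n. (cmod (v $ i))\<^sup>2)"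
  have "A $$ (j, i) = A $$ (i, j)" if "i < n" "j < n" for i j
    using that A arg_cong[OF sym, of "\<lambda>M. M $$ (i, j)"] by simp
  \<comment> \<open>Conjugation exchanges the roles of \<open>i\<close> and \<open>j\<close>, which
    the symmetry of \<open>A\<close> undoes.\<close>
  then have "cnj S = S"
    unfolding S_def by (subst (2) sum.swap) (simp add: ac_simps)
  moreover have "S = z * of_real t"
  proof -
    have "(\<Sum>j<n. of_real (A $$ (i, j)) * v $ j) = z * v $ i" if "i < n" for i
      using that A v(1) arg_cong[OF v(3), of "\<lambda>w. w $ i"]
      by (simp add: scalar_prod_def atLeast0LessThan)
    then have "S = (\<Sum>i<n. cnj (v $ i) * (z * v $ i))"
      unfolding S_def by (simp add: mult.assoc flip: sum_distrib_left)
    also have "\<dots> = (\<Sum>i<n. z * of_real ((cmod (v $ i))\<^sup>2))"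
      by (simp add: complex_norm_square ac_simps del: of_real_power)
    finally show ?thesis by (simp add: t_def sum_distrib_left)
  qed
  moreover have "t \<noteq> 0"
  proof -
    obtain i where "i < n" "v $ i \<noteq> 0"
      using v(1,2) by (metis carrier_vecD eq_vecI index_zero_vec(1) index_zero_vec(2))
    then show ?thesis by (auto simp: t_def sum_nonneg_eq_0_iff)
  qed
  ultimately have "cnj z = z" by simp
  then have "z = of_real (Re z)" by (simp add: complex_eq_iff)
  moreover have "poly (map_poly of_real (char_poly A)) z = 0"
    using z by (simp add: eigenvalue_root_char_poly[OF A'] of_real_hom.char_poly_hom[OF A])
  ultimately have "poly (char_poly A) (Re z) = 0"
    by (metis of_real_eq_0_iff of_real_hom.poly_map_poly)
  then show thesis
    using that by (simp add: eigenvalue_root_char_poly[OF A])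
qed

text \<open>The Householder reflection that exchanges \<open>v\<close> and the first unit vector. If \<open>v\<close> is that
  unit vector, then \<open>s = 0\<close>, and \<open>2 / s = 0\<close> gives the identity matrix.\<close>

lemma householder:
  fixes v :: "real vec"
  assumes v: "v \<in> carrier_vec n" and norm: "v \<bullet> v = 1" and n: "n > 0"
  obtains H where "H \<in> carrier_mat n n" "transpose_mat H = H" "H * H = 1\<^sub>m n" "col H 0 = v"
proof -
  define \<delta> :: "nat \<Rightarrow> nat \<Rightarrow> real" where "\<delta> i j = of_bool (i = j)" for i j
  define w where "w i = v $ i - \<delta> i 0" for i
  define s where "s = (\<Sum>i<n. (w i)\<^sup>2)"
  define c where "c = 2 / s"
  have c: "c * c * s = 2 * c" by (simp add: c_def)
  define H where "H = mat n n (\<lambda>(i, j). \<delta> i j - c * w i * w j)"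
  have carr: "H \<in> carrier_mat n n" by (simp add: H_def)
  have d_sum: "(\<Sum>k<n. \<delta> i k * f k) = f i" "(\<Sum>k<n. f k * \<delta> k i) = f i" if "i < n" for i f
    using that by (simp_all add: \<delta>_def of_bool_def if_distrib[of "\<lambda>x. x * _"] if_distrib[of "(*) _"] cong: if_cong)
  have "H * H = 1\<^sub>m n"
  proof (rule eq_matI)
    fix i j assume "i < dim_row (1\<^sub>m n :: real mat)" "j < dim_col (1\<^sub>m n :: real mat)"
    then have ij: "i < n" "j < n" by simp_all
    have "(H * H) $$ (i, j) = (\<Sum>k<n. (\<delta> i k - c * w i * w k) * (\<delta> k j - c * w k * w j))"
      using ij by (simp add: H_def scalar_prod_def atLeast0LessThan)
    also have "\<dots> = (\<Sum>k<n. \<delta> i k * \<delta> k j - \<delta> i k * (c * w k * w j)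
        - (c * w i * w k) * \<delta> k j + c * w i * (c * w j) * (w k)\<^sup>2)"
      by (intro sum.cong) (simp_all add: algebra_simps power2_eq_square)
    also have "\<dots> = (\<Sum>k<n. \<delta> i k * \<delta> k j) - (\<Sum>k<n. \<delta> i k * (c * w k * w j))
        - (\<Sum>k<n. (c * w i * w k) * \<delta> k j) + c * w i * (c * w j) * s"
      by (simp only: s_def sum_distrib_left sum.distrib sum_subtractf)
    also have "\<dots> = \<delta> i j + (c * c * s - 2 * c) * w i * w j"
      using ij by (simp only: d_sum) (simp add: algebra_simps)
    also have "\<dots> = \<delta> i j"
      by (simp add: c)
    finally show "(H * H) $$ (i, j) = 1\<^sub>m n $$ (i, j)"
      using ij by (simp add: \<delta>_def)
  qed (simp_all add: H_def)
  moreover have "col H 0 = v"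
  proof (rule eq_vecI)
    fix i assume "i < dim_vec v"
    then have i: "i < n" using v by simp
    \<comment> \<open>Both \<open>v\<close> and the first unit vector have norm 1, so
      \<open>s = 2 - 2 * v $ 0\<close>. Hence \<open>c * w 0 = - 1\<close> unless
      \<open>s = 0\<close>, in which case \<open>w\<close> vanishes altogether.\<close>
    have "s = (\<Sum>i<n. v $ i * v $ i) - 2 * (\<Sum>i<n. v $ i * \<delta> i 0) + (\<Sum>i<n. \<delta> i 0 * \<delta> i 0)"
      by (simp add: s_def w_def power2_eq_square algebra_simps sum_distrib_left
          flip: sum.distrib sum_subtractf)
    moreover have "(\<Sum>i<n. v $ i * v $ i) = 1"
      using v norm by (simp add: scalar_prod_def atLeast0LessThan)
    ultimately have s: "s = - 2 * w 0"
      using n by (simp add: d_sum w_def \<delta>_def)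
    have "w i = 0" if "w 0 = 0"
      using that s i by (auto simp: s_def sum_nonneg_eq_0_iff)
    then have "w i * (c * w 0) = - w i"
      by (cases "w 0 = 0") (simp_all add: c_def s)
    then show "col H 0 $ i = v $ i"
      using i n by (simp add: H_def w_def algebra_simps)
  qed (use carr v in simp_all)
  moreover have "transpose_mat H = H"
    by (rule eq_matI) (auto simp: H_def \<delta>_def)
  ultimately show thesis
    using that carr by blast
qed

lemma transpose_mat_diag [simp]: "transpose_mat (mat_diag n f) = mat_diag n f"
  by (rule eq_matI) (auto simp: mat_diag_def)

lemma four_block_mat_diag:
  "four_block_mat (mat_diag 1 (\<lambda>_. e)) (0\<^sub>m 1 m) (0\<^sub>m m 1) (mat_diag m f)
    = mat_diag (Suc m) (case_nat e f)"
  by (rule eq_matI) (auto simp: mat_diag_def split: nat.splits)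

text \<open>Deflation: a Householder reflection moves a unit eigenvector to the first unit vector,
  symmetry splits off a 1 x 1 block, and induction diagonalises the rest.\<close>

theorem spectral_decomposition:
  fixes A :: "real mat"
  assumes "A \<in> carrier_mat n n" and "transpose_mat A = A"
  obtains Q f where "Q \<in> carrier_mat n n" "transpose_mat Q * Q = 1\<^sub>m n" "Q * transpose_mat Q = 1\<^sub>m n"
    "A = Q * mat_diag n f * transpose_mat Q"
proof -
  have "\<exists>Q f. Q \<in> carrier_mat n n \<and> transpose_mat Q * Q = 1\<^sub>m n \<and> Q * transpose_mat Q = 1\<^sub>m n
      \<and> A = Q * mat_diag n f * transpose_mat Q"
    using assms
  proof (induction n arbitrary: A)
    case 0
    then show ?case
      by (intro exI[of _ "1\<^sub>m 0"] exI) (auto intro!: eq_matI)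
  next
    case (Suc m)
    let ?n = "Suc m"
    note A = Suc.prems(1) and sym = Suc.prems(2)
    obtain e u where u: "u \<in> carrier_vec ?n" "u \<noteq> 0\<^sub>v ?n" "A *\<^sub>v u = e \<cdot>\<^sub>v u"
      using symmetric_real_eigenvalue[OF A sym] A unfolding eigenvalue_def eigenvector_def
      by (metis carrier_matD(1) zero_less_Suc)
    define v where "v = (1 / sqrt (u \<bullet> u)) \<cdot>\<^sub>v u"
    have v: "v \<in> carrier_vec ?n" using u by (simp add: v_def)
    have uu: "u \<bullet> u > 0"
    proof -
      obtain i where "i < ?n" "u $ i \<noteq> 0"
        using u(1,2) by (metis carrier_vecD eq_vecI index_zero_vec(1) index_zero_vec(2))
      then have "(\<Sum>i<?n. (u $ i)\<^sup>2) > 0"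
        by (intro sum_pos2[of _ i]) auto
      then show ?thesis
        using u(1) by (simp add: scalar_prod_def atLeast0LessThan power2_eq_square)
    qed
    then have "v \<bullet> v = 1"
      using u(1) by (simp add: v_def)
    moreover have Av: "A *\<^sub>v v = e \<cdot>\<^sub>v v"
      using u A by (simp add: v_def mult_mat_vec smult_smult_assoc ac_simps)
    ultimately obtain H where H: "H \<in> carrier_mat ?n ?n" "transpose_mat H = H" "H * H = 1\<^sub>m ?n" "col H 0 = v"
      using householder[OF v] by blast
    define B where "B = H * A * H"
    have B: "B \<in> carrier_mat ?n ?n" using H A by (simp add: B_def)
    have symB: "transpose_mat B = B"
      using H A sym by (simp add: B_def transpose_mult[of _ ?n ?n _ ?n] assoc_mult_mat[of _ ?n ?n _ ?n _ ?n])
    \<comment> \<open>The first column of \<open>H\<close> is \<open>v\<close> and \<open>H\<close>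
      is an involution, so \<open>B\<close> sends the first unit vector to \<open>e\<close> times
      itself.\<close>
    have "B = H * (A * H)"
      using H(1) A by (simp add: B_def assoc_mult_mat[of _ ?n ?n _ ?n _ ?n])
    then have "col B 0 = H *\<^sub>v col (A * H) 0"
      using H(1) A by (simp only: col_mult2[of _ ?n ?n _ ?n] mult_carrier_mat[of _ ?n ?n _ ?n] zero_less_Suc)
    also have "col (A * H) 0 = A *\<^sub>v col H 0"
      using H(1) A by (intro col_mult2) auto
    also have "H *\<^sub>v (A *\<^sub>v col H 0) = e \<cdot>\<^sub>v (H *\<^sub>v col H 0)"
      using H(1,4) A v by (simp add: Av mult_mat_vec)
    also have "H *\<^sub>v col H 0 = col (H * H) 0"
      using H(1) by (intro col_mult2[symmetric]) auto
    finally have colB: "col B 0 = e \<cdot>\<^sub>v unit_vec ?n 0"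
      by (simp add: H(3))
    have Bi0: "B $$ (i, 0) = (if i = 0 then e else 0)" if "i < ?n" for i
      using that B arg_cong[OF colB, of "\<lambda>w. w $ i"] by auto
    have B_sym: "B $$ (i, j) = B $$ (j, i)" if "i < ?n" "j < ?n" for i j
      using that B arg_cong[OF symB, of "\<lambda>M. M $$ (i, j)"] by simp
    define C where "C = mat m m (\<lambda>(i, j). B $$ (Suc i, Suc j))"
    have C: "C \<in> carrier_mat m m" by (simp add: C_def)
    have "transpose_mat C = C"
      by (rule eq_matI) (auto simp: C_def intro: B_sym)
    from Suc.IH[OF C this] obtain Q f where Q: "Q \<in> carrier_mat m m" "transpose_mat Q * Q = 1\<^sub>m m"
      "Q * transpose_mat Q = 1\<^sub>m m" "C = Q * mat_diag m f * transpose_mat Q" by blast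
    \<comment> \<open>The first coordinate direction is already an eigenvector of \<open>B\<close>,
      so \<open>F\<close> acts on the other \<open>m\<close> only.\<close>
    define F where "F = four_block_mat (1\<^sub>m 1) (0\<^sub>m 1 m) (0\<^sub>m m 1) Q"
    have F: "F \<in> carrier_mat ?n ?n" using Q by (auto simp: F_def)
    have FT: "transpose_mat F = four_block_mat (1\<^sub>m 1) (0\<^sub>m 1 m) (0\<^sub>m m 1) (transpose_mat Q)"
      using Q(1) by (simp add: F_def transpose_four_block_mat[of _ 1 1 _ m _ m])
    have one: "four_block_mat (1\<^sub>m 1) (0\<^sub>m 1 m) (0\<^sub>m m 1) (1\<^sub>m m) = (1\<^sub>m ?n :: real mat)"
      by (rule eq_matI) auto
    have FTF: "transpose_mat F * F = 1\<^sub>m ?n"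
      unfolding FT unfolding F_def using Q(1,2)
      by (subst mult_four_block_mat[of _ 1 1 _ m _ m _ _ 1 _ m]) (auto simp: one)
    have FFT: "F * transpose_mat F = 1\<^sub>m ?n"
      unfolding FT unfolding F_def using Q(1,3)
      by (subst mult_four_block_mat[of _ 1 1 _ m _ m _ _ 1 _ m]) (auto simp: one)
    have "B = four_block_mat (mat_diag 1 (\<lambda>_. e)) (0\<^sub>m 1 m) (0\<^sub>m m 1) C"
    proof (rule eq_matI)
      fix i j
      assume "i < dim_row (four_block_mat (mat_diag 1 (\<lambda>_. e)) (0\<^sub>m 1 m) (0\<^sub>m m 1) C)"
        "j < dim_col (four_block_mat (mat_diag 1 (\<lambda>_. e)) (0\<^sub>m 1 m) (0\<^sub>m m 1) C)"
      then have ij: "i < ?n" "j < ?n" using C by (auto simp: mat_diag_def)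
      then show "B $$ (i, j) = four_block_mat (mat_diag 1 (\<lambda>_. e)) (0\<^sub>m 1 m) (0\<^sub>m m 1) C $$ (i, j)"
        using Bi0[of i] Bi0[of j] B_sym[of i j] by (auto simp: mat_diag_def C_def)
    qed (use B C in \<open>auto simp: mat_diag_def\<close>)
    also have "\<dots> = F * mat_diag ?n (case_nat e f) * transpose_mat F"
    proof -
      have "F * mat_diag ?n (case_nat e f)
          = four_block_mat (mat_diag 1 (\<lambda>_. e)) (0\<^sub>m 1 m) (0\<^sub>m m 1) (Q * mat_diag m f)"
        unfolding F_def four_block_mat_diag[symmetric] using Q(1)
        by (subst mult_four_block_mat[of _ 1 1 _ m _ m _ _ 1 _ m])
          (auto simp: left_mult_one_mat[OF mat_diag_dim] left_mult_zero_mat[OF mat_diag_dim]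
            right_add_zero_mat[OF mat_diag_dim])
      then show ?thesis
        unfolding FT using Q(1)
        by (simp only:, subst mult_four_block_mat[of _ 1 1 _ m _ m _ _ 1 _ m])
          (auto simp: Q(4) right_mult_one_mat[OF mat_diag_dim] right_mult_zero_mat[OF mat_diag_dim]
            right_add_zero_mat[OF mat_diag_dim] right_mult_zero_mat[of _ m m] left_add_zero_mat[of _ m m])
    qed
    finally have BF: "B = F * mat_diag ?n (case_nat e f) * transpose_mat F" .
    let ?D = "mat_diag ?n (case_nat e f)"
    have *: "transpose_mat (H * F) = transpose_mat F * H"
      using H F by (simp add: transpose_mult[of _ ?n ?n _ ?n])
    have assoc: "X * Y * Z = X * (Y * Z)" if "X \<in> carrier_mat ?n ?n" "Y \<in> carrier_mat ?n ?n" "Z \<in> carrier_mat ?n ?n"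
      for X Y Z :: "real mat"
      using that by (rule assoc_mult_mat)
    have FT_carr: "transpose_mat F \<in> carrier_mat ?n ?n" using F by simp
    have collapse: "X * (X' * Y) = Y" if "X * X' = 1\<^sub>m ?n" "X \<in> carrier_mat ?n ?n" "X' \<in> carrier_mat ?n ?n" "Y \<in> carrier_mat ?n ?n"
      for X X' Y :: "real mat"
      using that by (metis assoc left_mult_one_mat)
    have "transpose_mat (H * F) * (H * F) = 1\<^sub>m ?n"
      using H F FT_carr by (simp add: * assoc collapse FTF)
    moreover have "(H * F) * transpose_mat (H * F) = 1\<^sub>m ?n"
      using H F FT_carr by (simp add: * assoc collapse[OF FFT])
    moreover have "A = (H * F) * ?D * transpose_mat (H * F)"
    proof -
      have "A = H * B * H"
        using H A by (simp add: B_def assoc collapse)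
      also have "\<dots> = (H * F) * ?D * transpose_mat (H * F)"
        unfolding BF using H F FT_carr by (simp add: * assoc mult_carrier_mat[of _ ?n ?n _ ?n])
      finally show ?thesis .
    qed
    ultimately show ?case
      using H F by (intro exI[of _ "H * F"] exI[of _ "case_nat e f"]) auto
  qed
  then show thesis
    using that by blast
qed

section \<open>The polynomial \<open>det (1 + x A)\<close>\<close>

text \<open>The matrix is \<open>1 + x A\<close> over the polynomial ring, which gives access to
  coefficients. Unlike in the characteristic polynomial, \<open>S_k\<close> sits at degree
  \<open>k\<close> whatever the dimension, which suits an induction on it.\<close>

definition esp_poly :: "real mat \<Rightarrow> real poly" where
  "esp_poly A = det (mat (dim_row A) (dim_row A) (\<lambda>(i, j). [:of_bool (i = j), A $$ (i, j):]))"

lemma poly_esp_poly: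
  assumes "A \<in> carrier_mat n n"
  shows "poly (esp_poly A) x = det (1\<^sub>m n + x \<cdot>\<^sub>m A)"
  unfolding esp_poly_def using assms by (intro poly_det_cong[of _ n]) auto

lemma det_mat_diag: "det (mat_diag n f) = (\<Prod>i<n. f i :: 'a :: idom)"
proof -
  have "det (mat_diag n f) = prod_list (diag_mat (mat_diag n f))"
    by (rule det_upper_triangular[of _ n]) (auto simp: mat_diag_def)
  also have "diag_mat (mat_diag n f) = map f [0..<n]"
    by (auto simp: diag_mat_def mat_diag_def)
  finally show ?thesis
    by (simp add: atLeast0LessThan flip: prod.distinct_set_conv_list)
qed

lemma conj_mat_diag_index:
  fixes Q :: "'a :: comm_semiring_1 mat"
  assumes "Q \<in> carrier_mat n n" "i < n" "j < n"
  shows "(Q * mat_diag n g * transpose_mat Q) $$ (i, j) = (\<Sum>l<n. Q $$ (i, l) * g l * Q $$ (j, l))"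
  using assms by (simp add: mat_diag_mult_right[of _ n] scalar_prod_def atLeast0LessThan)

section \<open>Matrices with a common orthonormal eigenbasis\<close>

locale orthogonal_mat_n =
  fixes n :: nat and Q :: "real mat"
  assumes Q [simp]: "Q \<in> carrier_mat n n"
    and QTQ: "transpose_mat Q * Q = 1\<^sub>m n" and QQT: "Q * transpose_mat Q = 1\<^sub>m n"
begin

text \<open>The functional calculus in the eigenbasis formed by the columns of \<open>Q\<close>:
  \<open>1 + x A\<close>, its inverse and its determinant are all read off from
  \<open>g\<close>.\<close>

definition conj_diag :: "(nat \<Rightarrow> real) \<Rightarrow> real mat" where
  "conj_diag g = Q * mat_diag n g * transpose_mat Q"

lemma conj_diag_carrier [simp]: "conj_diag g \<in> carrier_mat n n"
  by (simp add: conj_diag_def mult_carrier_mat[of _ n n])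

lemma dim_conj_diag [simp]: "dim_row (conj_diag g) = n" "dim_col (conj_diag g) = n"
  using conj_diag_carrier[of g] by blast+

lemma conj_diag_index:
  "i < n \<Longrightarrow> j < n \<Longrightarrow> conj_diag g $$ (i, j) = (\<Sum>l<n. Q $$ (i, l) * g l * Q $$ (j, l))"
  unfolding conj_diag_def by (rule conj_mat_diag_index[OF Q])

lemma conj_diag_one: "conj_diag (\<lambda>_. 1) = 1\<^sub>m n"
  by (simp add: conj_diag_def QQT right_mult_one_mat[OF Q])

lemma conj_diag_linear: "1\<^sub>m n + x \<cdot>\<^sub>m conj_diag f = conj_diag (\<lambda>i. 1 + x * f i)"
proof (rule eq_matI)
  fix i j assume "i < dim_row (conj_diag (\<lambda>i. 1 + x * f i))" "j < dim_col (conj_diag (\<lambda>i. 1 + x * f i))"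
  then have ij: "i < n" "j < n"
    by simp_all
  have "(1\<^sub>m n + x \<cdot>\<^sub>m conj_diag f) $$ (i, j) = conj_diag (\<lambda>_. 1) $$ (i, j) + x * conj_diag f $$ (i, j)"
    using ij by (simp add: conj_diag_one)
  also have "\<dots> = conj_diag (\<lambda>i. 1 + x * f i) $$ (i, j)"
    unfolding conj_diag_index[OF ij] sum_distrib_left sum.distrib[symmetric]
    by (intro sum.cong) (simp_all add: algebra_simps)
  finally show "(1\<^sub>m n + x \<cdot>\<^sub>m conj_diag f) $$ (i, j) = conj_diag (\<lambda>i. 1 + x * f i) $$ (i, j)" .
qed simp_all

lemma conj_diag_mult: "conj_diag g * conj_diag h = conj_diag (\<lambda>i. g i * h i)"
proof -
  have assoc: "X * Y * Z = X * (Y * Z)"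
    if "X \<in> carrier_mat n n" "Y \<in> carrier_mat n n" "Z \<in> carrier_mat n n" for X Y Z :: "real mat"
    using that by (rule assoc_mult_mat)
  have QT: "transpose_mat Q \<in> carrier_mat n n" by simp
  have "transpose_mat Q * (Q * Y) = Y" if "Y \<in> carrier_mat n n" for Y
    using that by (metis assoc QT Q QTQ left_mult_one_mat)
  then have "conj_diag g * conj_diag h = Q * ((mat_diag n g * mat_diag n h) * transpose_mat Q)"
    unfolding conj_diag_def using QT by (simp add: assoc mult_carrier_mat[of _ n n] del: mat_diag_diag)
  then show ?thesis
    unfolding conj_diag_def using QT by (simp add: assoc)
qed

lemma conj_diag_inverse:
  assumes "\<And>i. i < n \<Longrightarrow> g i \<noteq> 0"
  shows "conj_diag g * conj_diag (\<lambda>i. 1 / g i) = 1\<^sub>m n"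
    and "conj_diag (\<lambda>i. 1 / g i) * conj_diag g = 1\<^sub>m n"
proof -
  have "mat_diag n (\<lambda>i. g i * (1 / g i)) = mat_diag n (\<lambda>_. 1)"
    "mat_diag n (\<lambda>i. 1 / g i * g i) = mat_diag n (\<lambda>_. 1)"
    using assms by (auto simp: mat_diag_def intro!: eq_matI)
  then have "conj_diag (\<lambda>i. g i * (1 / g i)) = conj_diag (\<lambda>_. 1)"
    "conj_diag (\<lambda>i. 1 / g i * g i) = conj_diag (\<lambda>_. 1)"
    by (simp_all only: conj_diag_def)
  then show "conj_diag g * conj_diag (\<lambda>i. 1 / g i) = 1\<^sub>m n"
    "conj_diag (\<lambda>i. 1 / g i) * conj_diag g = 1\<^sub>m n"
    by (simp_all only: conj_diag_mult conj_diag_one)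
qed

lemma det_conj_diag: "det (conj_diag g) = (\<Prod>i<n. g i)"
proof -
  have "det Q * det (transpose_mat Q) = 1"
    using arg_cong[OF QQT, of det] by (simp add: det_mult[of _ n])
  then show ?thesis
    unfolding conj_diag_def
    by (simp add: det_mult[of _ n] mult_carrier_mat[of _ n n] det_mat_diag)
qed


lemma esp_poly_conj_diag: "esp_poly (conj_diag f) = (\<Prod>i<n. [:1, f i:])"
  by (rule poly_ext)
    (simp add: poly_esp_poly[OF conj_diag_carrier] conj_diag_linear det_conj_diag poly_prod)

lemma char_poly_conj_diag: "char_poly (conj_diag f) = (\<Prod>i<n. [:- f i, 1:])"
proof -
  have "similar_mat (conj_diag f) (mat_diag n f)"
    unfolding similar_mat_def
    by (intro exI[of _ Q] exI[of _ "transpose_mat Q"] similar_mat_witI[of Q "transpose_mat Q" n]) (simp_all add: QQT QTQ conj_diag_def mult_carrier_mat[of _ n n])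
  then have "char_poly (conj_diag f) = char_poly (mat_diag n f)"
    by (rule char_poly_similar)
  also have "\<dots> = (\<Prod>a\<leftarrow>diag_mat (mat_diag n f). [:- a, 1:])"
    by (rule char_poly_upper_triangular[of _ n]) (auto simp: mat_diag_def)
  also have "diag_mat (mat_diag n f) = map f [0..<n]"
    by (auto simp: diag_mat_def mat_diag_def)
  finally show ?thesis
    by (simp add: comp_def atLeast0LessThan flip: prod.distinct_set_conv_list)
qed

end

section \<open>Determinants of principal minors and of bordered matrices\<close>

lemma poly_eqI_off_roots:
  fixes p q r :: "real poly"
  assumes "r \<noteq> 0" and "\<And>x. poly r x \<noteq> 0 \<Longrightarrow> poly p x = poly q x"
  shows "p = q"
proof -
  have "r * p = r * q"
    using assms(2) by (intro poly_ext) (metis mult_eq_0_iff poly_mult)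
  then show ?thesis using assms(1) by simp
qed

lemma prod_linear_nonzero: "(\<Prod>i\<in>I. [:1, f i :: real:]) \<noteq> 0"
proof -
  have "poly (\<Prod>i\<in>I. [:1, f i:]) 0 = 1" by (simp add: poly_prod)
  then show ?thesis by (metis poly_0 zero_neq_one)
qed

text \<open>Cramer's rule: the last principal minor of \<open>M = 1 + x A\<close> is
  \<open>det M\<close> times a diagonal entry of the inverse, which in the eigenbasis is the sum of
  \<open>1 / g l\<close> with weights \<open>(Q $$ (m, l))^2\<close>.\<close>

lemma (in orthogonal_mat_n) esp_poly_principal_minor:
  assumes n: "n = Suc m" and A: "A = conj_diag f"
  shows "esp_poly (mat m m (\<lambda>(i, j). A $$ (i, j)))
    = (\<Sum>l<n. Polynomial.smult ((Q $$ (m, l))\<^sup>2) (\<Prod>i\<in>{..<n} - {l}. [:1, f i:]))"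
\<comment> \<open>Off the roots of this product \<open>1 + x A\<close> is invertible and division by
  \<open>g l\<close> is legitimate.\<close>
proof (rule poly_eqI_off_roots)
  fix x assume "poly (\<Prod>i<n. [:1, f i:]) x \<noteq> 0"
  moreover define g where "g = (\<lambda>i. 1 + x * f i)"
  ultimately have nz: "g i \<noteq> 0" if "i < n" for i
    using that by (auto simp: poly_prod)
  let ?M = "conj_diag g" and ?N = "conj_diag (\<lambda>i. 1 / g i)"
  have M: "1\<^sub>m n + x \<cdot>\<^sub>m A = ?M"
    unfolding A conj_diag_linear g_def ..
  have m: "m < n" by (simp add: n)
  have A_carr: "A \<in> carrier_mat n n" by (simp add: A)
  have MN: "?M * ?N = 1\<^sub>m n"
    using nz by (rule conj_diag_inverse(1))
  note adj = adj_mat[OF conj_diag_carrier[of g]]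
  have "adj_mat ?M = adj_mat ?M * (?M * ?N)"
    using adj(1) by (simp add: MN)
  also have "\<dots> = (adj_mat ?M * ?M) * ?N"
    using adj(1) by (simp add: assoc_mult_mat[of _ n n _ n _ n])
  also have "\<dots> = det ?M \<cdot>\<^sub>m ?N"
    unfolding adj(3) by (simp add: mult_smult_assoc_mat[of _ n n _ n] left_mult_one_mat[OF conj_diag_carrier])
  finally have "adj_mat ?M $$ (m, m) = det ?M * ?N $$ (m, m)"
    using m by simp
  moreover have "adj_mat ?M $$ (m, m) = det (mat_delete ?M m m)"
    using m by (simp add: adj_mat_def cofactor_def)
  \<comment> \<open>The deleted row and column are the last ones, so no indices shift.\<close>
  moreover have "mat_delete ?M m m = 1\<^sub>m m + x \<cdot>\<^sub>m mat m m (\<lambda>(i, j). A $$ (i, j))"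
    unfolding M[symmetric] using n A_carr by (intro eq_matI) (auto simp: mat_delete_def)
  ultimately have "poly (esp_poly (mat m m (\<lambda>(i, j). A $$ (i, j)))) x = det ?M * ?N $$ (m, m)"
    by (simp add: poly_esp_poly[of _ m])
  also have "\<dots> = (\<Sum>l<n. (Q $$ (m, l))\<^sup>2 * (det ?M / g l))"
    unfolding conj_diag_index[OF m m] sum_distrib_left
    by (intro sum.cong) (simp_all add: power2_eq_square)
  also have "\<dots> = (\<Sum>l<n. (Q $$ (m, l))\<^sup>2 * (\<Prod>i\<in>{..<n} - {l}. g i))"
  proof (intro sum.cong refl arg_cong2[of _ _ _ _ "(*)"])
    fix l assume "l \<in> {..<n}"
    moreover from this have "det ?M = g l * (\<Prod>i\<in>{..<n} - {l}. g i)"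
      unfolding det_conj_diag by (intro prod.remove) auto
    ultimately show "det ?M / g l = (\<Prod>i\<in>{..<n} - {l}. g i)"
      using nz[of l] by simp
  qed
  finally show "poly (esp_poly (mat m m (\<lambda>(i, j). A $$ (i, j)))) x
      = poly (\<Sum>l<n. Polynomial.smult ((Q $$ (m, l))\<^sup>2) (\<Prod>i\<in>{..<n} - {l}. [:1, f i:])) x"
    by (simp add: poly_sum poly_prod g_def)
qed (rule prod_linear_nonzero)

text \<open>Schur complement: \<open>det (1 + x A) = det M * (d - b^T M^-1 b)\<close>, where
  \<open>M = 1 + x B\<close> is diagonal in the eigenbasis \<open>Q\<close> and \<open>c\<close>
  holds the coordinates of the border.\<close>

lemma (in orthogonal_mat_n) esp_poly_bordered:
  assumes A: "A \<in> carrier_mat (Suc n) (Suc n)" and sym: "transpose_mat A = A"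
    and B: "mat n n (\<lambda>(i, j). A $$ (i, j)) = conj_diag f"
  defines "c \<equiv> \<lambda>l. \<Sum>i<n. Q $$ (i, l) * A $$ (i, n)"
  shows "esp_poly A = [:1, A $$ (n, n):] * (\<Prod>i<n. [:1, f i:])
    - monom 1 2 * (\<Sum>l<n. Polynomial.smult ((c l)\<^sup>2) (\<Prod>i\<in>{..<n} - {l}. [:1, f i:]))"
proof (rule poly_eqI_off_roots)
  fix x assume "poly (\<Prod>i<n. [:1, f i:]) x \<noteq> 0"
  moreover define g where "g = (\<lambda>i. 1 + x * f i)"
  ultimately have nz: "g i \<noteq> 0" if "i < n" for i
    using that by (auto simp: poly_prod)
  define M N where "M = conj_diag g" and "N = conj_diag (\<lambda>i. 1 / g i)"
  have M: "M \<in> carrier_mat n n" and N: "N \<in> carrier_mat n n"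
    by (simp_all add: M_def N_def)
  have NM: "N * M = 1\<^sub>m n"
    unfolding M_def N_def using nz by (rule conj_diag_inverse(2))
  \<comment> \<open>The border of \<open>1 + x A\<close> carries a factor \<open>x\<close>; it
    enters the Schur complement twice, which yields \<open>monom 1 2\<close>.\<close>
  define b where "b = mat n 1 (\<lambda>(i, _). x * A $$ (i, n))"
  have b: "b \<in> carrier_mat n 1" "transpose_mat b \<in> carrier_mat 1 n" by (simp_all add: b_def)
  define d where "d = mat 1 1 (\<lambda>_. 1 + x * A $$ (n, n))"
  have d: "d \<in> carrier_mat 1 1" by (simp add: d_def)
  have A_sym: "A $$ (i, j) = A $$ (j, i)" if "i < Suc n" "j < Suc n" for i j
    using that A arg_cong[OF sym, of "\<lambda>M. M $$ (i, j)"] by simp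
  have M_index: "M $$ (i, j) = of_bool (i = j) + x * A $$ (i, j)" if "i < n" "j < n" for i j
  proof -
    have "M = 1\<^sub>m n + x \<cdot>\<^sub>m mat n n (\<lambda>(i, j). A $$ (i, j))"
      unfolding M_def g_def B conj_diag_linear ..
    then show ?thesis using that by simp
  qed
  have block: "1\<^sub>m (Suc n) + x \<cdot>\<^sub>m A = four_block_mat M b (transpose_mat b) d"
  proof (rule eq_matI)
    fix i j
    assume "i < dim_row (four_block_mat M b (transpose_mat b) d)"
      "j < dim_col (four_block_mat M b (transpose_mat b) d)"
    then have ij: "i < Suc n" "j < Suc n" using M d by auto
    then show "(1\<^sub>m (Suc n) + x \<cdot>\<^sub>m A) $$ (i, j) = four_block_mat M b (transpose_mat b) d $$ (i, j)"
      using A M M_index[of i j] A_sym[of n j] by (auto simp: b_def d_def less_Suc_eq)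
  qed (use A M d in auto)
  define S where "S = transpose_mat b * N * b"
  have S: "S \<in> carrier_mat 1 1" using b N by (simp add: S_def)
  \<comment> \<open>Block elimination: \<open>L\<close> has determinant 1 and clears the lower left
    block, leaving the Schur complement \<open>d - S\<close> in the corner.\<close>
  define L where "L = four_block_mat (1\<^sub>m n) (0\<^sub>m n 1) (- (transpose_mat b * N)) (1\<^sub>m 1)"
  have bN: "transpose_mat b * N \<in> carrier_mat 1 n" using b N by simp
  have bNM: "transpose_mat b * N * M = transpose_mat b"
    using b(2) N M NM by (metis assoc_mult_mat right_mult_one_mat)
  have L: "L \<in> carrier_mat (Suc n) (Suc n)" by (auto simp: L_def)
  have "L * four_block_mat M b (transpose_mat b) d
      = four_block_mat M b (0\<^sub>m 1 n) (d - S)"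
  proof -
    have "- (transpose_mat b * N) * M = - (transpose_mat b)"
      using bN M by (metis bNM carrier_matD uminus_mult_left_mat)
    then have "- (transpose_mat b * N) * M + 1\<^sub>m 1 * transpose_mat b = 0\<^sub>m 1 n"
      using b(2) by (simp only: left_mult_one_mat[OF b(2)] uminus_l_inv_mat)
    moreover have "- (transpose_mat b * N) * b + 1\<^sub>m 1 * d = d - S"
      using bN b(1) d S by (intro eq_matI) (auto simp: S_def left_mult_one_mat[OF d])
    moreover have "1\<^sub>m n * M + 0\<^sub>m n 1 * transpose_mat b = M"
      using M b(2) by (intro eq_matI) (auto simp: left_mult_one_mat[OF M] left_mult_zero_mat[OF b(2)])
    moreover have "1\<^sub>m n * b + 0\<^sub>m n 1 * d = b"
      using b(1) d by (intro eq_matI) (auto simp: left_mult_one_mat[OF b(1)] left_mult_zero_mat[OF d])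
    ultimately show ?thesis
      unfolding L_def using M b bN d
      by (subst mult_four_block_mat[of _ n n _ 1 _ 1 _ _ n _ 1]) auto
  qed
  moreover have "det L = 1"
    unfolding L_def using bN
    by (subst det_four_block_mat_upper_right_zero[of _ n _ 1]) auto
  moreover have "det (four_block_mat M b (0\<^sub>m 1 n) (d - S)) = det M * (d - S) $$ (0, 0)"
  proof -
    have "d - S \<in> carrier_mat 1 1" using S by (rule minus_carrier_mat)
    then show ?thesis
      using M b(1) by (simp add: det_four_block_mat_lower_left_zero[of _ n _ 1] det_single del: index_minus_mat)
  qed
  ultimately have "det (1\<^sub>m (Suc n) + x \<cdot>\<^sub>m A) = det M * (1 + x * A $$ (n, n) - S $$ (0, 0))"
    using det_mult[of L "Suc n" "four_block_mat M b (transpose_mat b) d"] L four_block_carrier_mat[OF M d, of b "transpose_mat b"] S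
    unfolding block by (simp add: d_def)
  moreover have "S $$ (0, 0) = x\<^sup>2 * (\<Sum>l<n. (c l)\<^sup>2 / g l)"
  proof -
    have "S $$ (0, 0) = (\<Sum>j<n. (\<Sum>i<n. x * A $$ (i, n) * N $$ (i, j)) * (x * A $$ (j, n)))"
      using b N by (simp add: S_def b_def scalar_prod_def atLeast0LessThan)
    also have "\<dots> = (\<Sum>j<n. \<Sum>i<n. \<Sum>l<n. x\<^sup>2 * ((Q $$ (i, l) * A $$ (i, n)) * (Q $$ (j, l) * A $$ (j, n)) / g l))"
      by (simp add: N_def conj_diag_index sum_distrib_left sum_distrib_right power2_eq_square mult_ac)
    \<comment> \<open>With \<open>l\<close> outermost, the double sum over \<open>i\<close> and
      \<open>j\<close> factors into the square of \<open>c l\<close>.\<close>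
    also have "\<dots> = (\<Sum>l<n. \<Sum>j<n. \<Sum>i<n. x\<^sup>2 * ((Q $$ (i, l) * A $$ (i, n)) * (Q $$ (j, l) * A $$ (j, n)) / g l))"
      by (subst sum.swap, subst (2) sum.swap, subst sum.swap) (rule sum.cong[OF refl sum.swap])
    also have "\<dots> = (\<Sum>l<n. x\<^sup>2 * ((c l)\<^sup>2 / g l))"
      by (simp add: c_def power2_eq_square sum_product sum_distrib_left sum_divide_distrib mult_ac)
    finally show ?thesis by (simp add: sum_distrib_left)
  qed
  moreover have "det M * (x\<^sup>2 * (\<Sum>l<n. (c l)\<^sup>2 / g l)) = x\<^sup>2 * (\<Sum>l<n. (c l)\<^sup>2 * (\<Prod>i\<in>{..<n} - {l}. g i))"
  proof -
    have "det M * (x\<^sup>2 * ((c l)\<^sup>2 / g l)) = x\<^sup>2 * ((c l)\<^sup>2 * (\<Prod>i\<in>{..<n} - {l}. g i))" if l: "l < n" for l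
    proof -
      have "det M = g l * (\<Prod>i\<in>{..<n} - {l}. g i)"
        unfolding M_def det_conj_diag using l by (intro prod.remove) auto
      then show ?thesis using nz[OF l] by simp
    qed
    then show ?thesis unfolding sum_distrib_left by (intro sum.cong) auto
  qed
  ultimately have "det (1\<^sub>m (Suc n) + x \<cdot>\<^sub>m A) = (1 + x * A $$ (n, n)) * (\<Prod>i<n. g i)
      - x\<^sup>2 * (\<Sum>l<n. (c l)\<^sup>2 * (\<Prod>i\<in>{..<n} - {l}. g i))"
    by (simp add: right_diff_distrib mult.commute M_def det_conj_diag)
  then show "poly (esp_poly A) x = poly ([:1, A $$ (n, n):] * (\<Prod>i<n. [:1, f i:])
    - monom 1 2 * (\<Sum>l<n. Polynomial.smult ((c l)\<^sup>2) (\<Prod>i\<in>{..<n} - {l}. [:1, f i:]))) x"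
    by (simp add: poly_esp_poly[OF A] poly_sum poly_prod poly_monom g_def
        distrib_right mult.assoc)
qed (rule prod_linear_nonzero)

section \<open>The induction over borders\<close>

lemma spectral_decomposition_conj_diag:
  assumes "A \<in> carrier_mat n n" and "transpose_mat A = A"
  obtains Q f where "orthogonal_mat_n n Q" "A = orthogonal_mat_n.conj_diag n Q f"
proof -
  obtain Q f where Q: "Q \<in> carrier_mat n n" "transpose_mat Q * Q = 1\<^sub>m n" "Q * transpose_mat Q = 1\<^sub>m n"
    and f: "A = Q * mat_diag n f * transpose_mat Q"
    using spectral_decomposition[OF assms] by blast
  interpret orthogonal_mat_n n Q using Q by unfold_locales
  show thesis using that[of Q f] f by (simp add: conj_diag_def orthogonal_mat_n_axioms)
qed

lemma (in orthogonal_mat_n) QQT_index: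
  assumes "i < n" "j < n"
  shows "(\<Sum>l<n. Q $$ (i, l) * Q $$ (j, l)) = of_bool (i = j)"
  using conj_diag_index[OF assms, of "\<lambda>_. 1"] assms by (cases "i = j") (simp_all add: conj_diag_one)

text \<open>Each removal of a factor costs one degree of positivity. The induction applies this to
  the eigenvalues of \<open>A\<close>, reaching degree \<open>k - 1\<close>, and then to those of
  \<open>B\<close>, reaching \<open>k - 2\<close>.\<close>

lemma coeff_remove_linear_factor_pos:
  fixes f :: "nat \<Rightarrow> real"
  assumes P: "real_rooted P" "coeff P 0 = 1" and l: "l < n"
    and pos: "\<And>j. j \<le> Suc k \<Longrightarrow> coeff ((\<Prod>i<n. [:1, f i:]) * P) j > 0" and "j \<le> k"
  shows "coeff ((\<Prod>i\<in>{..<n} - {l}. [:1, f i:]) * P) j > 0"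
proof (rule pos_coeffs_remove_factor)
  show "real_rooted ((\<Prod>i\<in>{..<n} - {l}. [:1, f i:]) * P)"
    by (intro real_rooted_mult real_rooted_prod real_rooted_linear P(1))
  show "coeff ((\<Prod>i\<in>{..<n} - {l}. [:1, f i:]) * P) 0 > 0"
    using P(2) by (simp add: poly_0_coeff_0[symmetric] poly_prod)
  fix j assume "j \<le> Suc k"
  then have "coeff ((\<Prod>i<n. [:1, f i:]) * P) j > 0" by (rule pos)
  also have "(\<Prod>i<n. [:1, f i:]) = [:1, f l:] * (\<Prod>i\<in>{..<n} - {l}. [:1, f i:])"
    using l by (intro prod.remove) auto
  finally show "coeff ([:1, f l:] * ((\<Prod>i\<in>{..<n} - {l}. [:1, f i:]) * P)) j > 0"
    by (simp only: mult.assoc)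
qed fact

text \<open>The factor \<open>P\<close> carries the diagonal entries that the induction has already split off.\<close>

lemma esp_poly_le_diag:
  assumes "A \<in> carrier_mat n n" "transpose_mat A = A" "real_rooted P" "coeff P 0 = 1"
    and k: "k \<ge> 2" and "\<And>j. j \<le> k \<Longrightarrow> coeff (esp_poly A * P) j > 0"
  shows "coeff (esp_poly A * P) k \<le> coeff ((\<Prod>i<n. [:1, A $$ (i, i):]) * P) k
    \<and> (coeff (esp_poly A * P) k = coeff ((\<Prod>i<n. [:1, A $$ (i, i):]) * P) k \<longrightarrow> diagonal_mat A)"
  using assms(1-4,6)
proof (induction n arbitrary: A P)
  case 0
  then show ?case by (auto simp: esp_poly_def diagonal_mat_def)
next
  case (Suc n)
  note A = Suc.prems(1) and sym = Suc.prems(2) and P = Suc.prems(3,4) and pos = Suc.prems(5)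
  have A_sym: "A $$ (i, j) = A $$ (j, i)" if "i < Suc n" "j < Suc n" for i j
    using that A arg_cong[OF sym, of "\<lambda>M. M $$ (i, j)"] by simp
  define B where "B = mat n n (\<lambda>(i, j). A $$ (i, j))"
  have B: "B \<in> carrier_mat n n" by (simp add: B_def)
  have symB: "transpose_mat B = B"
    by (rule eq_matI) (auto simp: B_def intro: A_sym)
  define a where "a = A $$ (n, n)"
  \<comment> \<open>First loss of a degree: \<open>esp_poly B\<close> combines, with nonnegative
    weights, the products with one eigenvalue of \<open>A\<close> deleted.\<close>
  have posB: "coeff (esp_poly B * P) j > 0" if j: "j \<le> k - 1" for j
  proof -
    obtain Q f where "orthogonal_mat_n (Suc n) Q" and Af: "A = orthogonal_mat_n.conj_diag (Suc n) Q f"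
      using spectral_decomposition_conj_diag[OF A sym] by blast
    then interpret orthogonal_mat_n "Suc n" Q by simp
    have *: "coeff ((\<Prod>i\<in>{..<Suc n} - {l}. [:1, f i:]) * P) j > 0" if "l < Suc n" for l
    proof (rule coeff_remove_linear_factor_pos[OF P that _ j])
      fix j assume "j \<le> Suc (k - 1)"
      then show "coeff ((\<Prod>i<Suc n. [:1, f i:]) * P) j > 0"
        using pos[of j] k unfolding Af esp_poly_conj_diag by simp
    qed
    \<comment> \<open>The last row of \<open>Q\<close> is a unit vector, so some weight is positive
      and the combination is strictly positive.\<close>
    have "(\<Sum>l<Suc n. (Q $$ (n, l))\<^sup>2) = 1"
      using QQT_index[of n n] by (simp add: power2_eq_square)
    then obtain l where l: "l < Suc n" "Q $$ (n, l) \<noteq> 0"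
      by (metis (no_types, lifting) lessThan_iff sum.neutral zero_neq_one zero_power2)
    have "esp_poly B * P = (\<Sum>l<Suc n. Polynomial.smult ((Q $$ (n, l))\<^sup>2) ((\<Prod>i\<in>{..<Suc n} - {l}. [:1, f i:]) * P))"
      unfolding B_def esp_poly_principal_minor[OF refl Af] sum_distrib_right mult_smult_left ..
    then have "coeff (esp_poly B * P) j
        = (\<Sum>l<Suc n. (Q $$ (n, l))\<^sup>2 * coeff ((\<Prod>i\<in>{..<Suc n} - {l}. [:1, f i:]) * P) j)"
      by (simp only: coeff_sum coeff_smult)
    also have "\<dots> > 0"
      using l * less_imp_le[OF *]
      by (intro sum_pos2[of _ l]) (auto intro!: mult_nonneg_nonneg simp del: lessThan_Suc)
    finally show ?thesis .
  qed
  \<comment> \<open>From here on \<open>Q\<close> and \<open>f\<close> belong to \<open>B\<close>,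
    no longer to \<open>A\<close>.\<close>
  obtain Q f where "orthogonal_mat_n n Q" and Bf: "B = orthogonal_mat_n.conj_diag n Q f"
    using spectral_decomposition_conj_diag[OF B symB] by blast
  then interpret orthogonal_mat_n n Q by simp
  define c where "c = (\<lambda>l. \<Sum>i<n. Q $$ (i, l) * A $$ (i, n))"
  define G where "G l = (\<Prod>i\<in>{..<n} - {l}. [:1, f i:]) * P" for l
  \<comment> \<open>Second loss of a degree; \<open>k - 2\<close> is exactly the degree that
    \<open>monom 1 2\<close> lifts to \<open>k\<close>.\<close>
  have G: "coeff (G l) j > 0" if "l < n" "j \<le> k - 2" for l j
    unfolding G_def
  proof (rule coeff_remove_linear_factor_pos[OF P \<open>l < n\<close> _ \<open>j \<le> k - 2\<close>])
    fix j assume "j \<le> Suc (k - 2)"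
    then show "coeff ((\<Prod>i<n. [:1, f i:]) * P) j > 0"
      using posB[of j] k unfolding Bf esp_poly_conj_diag by simp
  qed
  \<comment> \<open>The corner entry is absorbed into the cofactor, so that the induction hypothesis
    can be applied to \<open>B\<close> and \<open>P'\<close>.\<close>
  define P' where "P' = [:1, a:] * P"
  define R where "R = (\<Sum>l<n. Polynomial.smult ((c l)\<^sup>2) (G l))"
  have EA: "esp_poly A * P = esp_poly B * P' - monom 1 2 * R"
  proof -
    have "esp_poly A * P = ([:1, a:] * esp_poly B) * P
        - monom 1 2 * ((\<Sum>l<n. Polynomial.smult ((c l)\<^sup>2) (\<Prod>i\<in>{..<n} - {l}. [:1, f i:])) * P)"
      unfolding esp_poly_bordered[OF A sym Bf[unfolded B_def]] left_diff_distrib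
      by (simp only: Bf esp_poly_conj_diag a_def c_def mult.assoc)
    also have "([:1, a:] * esp_poly B) * P = esp_poly B * P'"
      by (simp only: P'_def mult_ac)
    finally show ?thesis
      by (simp only: R_def G_def sum_distrib_right mult_smult_left)
  qed
  have coeff_EA: "coeff (esp_poly A * P) j = coeff (esp_poly B * P') j - (if j < 2 then 0 else coeff R (j - 2))" for j
    unfolding EA by (simp add: coeff_monom_mult)
  have coeff_R: "coeff R j = (\<Sum>l<n. (c l)\<^sup>2 * coeff (G l) j)" for j
    by (simp add: R_def coeff_sum)
  have R_nonneg: "coeff R j \<ge> 0" if "j \<le> k - 2" for j
    unfolding coeff_R using G that by (intro sum_nonneg mult_nonneg_nonneg) (auto intro: less_imp_le)
  have pos': "coeff (esp_poly B * P') j > 0" if "j \<le> k" for j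
  proof -
    \<comment> \<open>Adding back the nonnegative correction keeps all degrees up to
      \<open>k\<close> positive. For \<open>j < 2\<close> the truncated difference is 0 and no
      correction occurs.\<close>
    have "coeff R (j - 2) \<ge> 0" using that by (intro R_nonneg) simp
    then show ?thesis using pos[OF that] unfolding coeff_EA by (auto split: if_splits)
  qed
  have P': "real_rooted P'" "coeff P' 0 = 1"
    unfolding P'_def using P by (simp_all only: real_rooted_mult real_rooted_linear) simp
  have diag: "(\<Prod>i<n. [:1, B $$ (i, i):]) * P' = (\<Prod>i<Suc n. [:1, A $$ (i, i):]) * P"
  proof -
    have "(\<Prod>i<n. [:1, B $$ (i, i):]) = (\<Prod>i<n. [:1, A $$ (i, i):])"
      by (intro prod.cong) (auto simp: B_def)
    then show ?thesis by (simp only: P'_def a_def prod.lessThan_Suc mult_ac)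
  qed
  have IH: "coeff (esp_poly B * P') k \<le> coeff ((\<Prod>i<Suc n. [:1, A $$ (i, i):]) * P) k"
    "coeff (esp_poly B * P') k = coeff ((\<Prod>i<Suc n. [:1, A $$ (i, i):]) * P) k \<Longrightarrow> diagonal_mat B"
    using Suc.IH[OF B symB P' pos'] unfolding diag by blast+
  have EA_k: "coeff (esp_poly A * P) k = coeff (esp_poly B * P') k - coeff R (k - 2)"
    using k by (simp add: coeff_EA)
  have R_k: "coeff R (k - 2) \<ge> 0" by (rule R_nonneg) simp
  have "diagonal_mat A" if eq: "coeff (esp_poly A * P) k = coeff ((\<Prod>i<Suc n. [:1, A $$ (i, i):]) * P) k"
  proof -
    \<comment> \<open>Overall equality forces equality both in the induction hypothesis and in
      deleting the border; as the coefficients of \<open>G\<close> are positive, every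
      \<open>c l\<close> must vanish.\<close>
    have "diagonal_mat B" and "coeff R (k - 2) = 0"
      using eq IH EA_k R_k by linarith+
    then have "(c l)\<^sup>2 * coeff (G l) (k - 2) = 0" if "l < n" for l
      using that less_imp_le[OF G] unfolding coeff_R
      by (subst (asm) sum_nonneg_eq_0_iff) auto
    then have c: "c l = 0" if "l < n" for l
      using that G[of l "k - 2"] by fastforce
    have An: "A $$ (i, n) = 0" if i: "i < n" for i
    proof -
      \<comment> \<open>The rows of \<open>Q\<close> are orthonormal, so the border is recovered
        from its coordinates \<open>c\<close>.\<close>
      have "0 = (\<Sum>l<n. Q $$ (i, l) * c l)" using c by simp
      also have "\<dots> = (\<Sum>j<n. (\<Sum>l<n. Q $$ (i, l) * Q $$ (j, l)) * A $$ (j, n))"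
        unfolding c_def sum_distrib_left sum_distrib_right by (subst sum.swap) (simp add: mult.assoc)
      also have "\<dots> = (\<Sum>j<n. of_bool (i = j) * A $$ (j, n))"
        using i by (intro sum.cong) (auto simp: QQT_index)
      also have "\<dots> = A $$ (i, n)"
        using i by (simp add: of_bool_def if_distrib[of "\<lambda>x. x * _"] cong: if_cong)
      finally show ?thesis by simp
    qed
    have "A $$ (i, j) = 0" if "i < n" "j < n" "i \<noteq> j" for i j
      using \<open>diagonal_mat B\<close> that by (simp add: diagonal_mat_def B_def)
    then show ?thesis
      using A An A_sym[of n] unfolding diagonal_mat_def by (auto simp: less_Suc_eq)
  qed
  then show ?case
    using IH(1) EA_k R_k by linarith
qed

section \<open>Elementary symmetric functions as coefficients\<close>

lemma coeff_prod_linear: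
  fixes f :: "'a \<Rightarrow> real"
  assumes "finite I"
  shows "coeff (\<Prod>i\<in>I. [:1, f i:]) k = (\<Sum>J | J \<subseteq> I \<and> card J = k. \<Prod>i\<in>J. f i)"
proof -
  have monom: "(\<Prod>i\<in>J. monom (f i) (Suc 0)) = monom (\<Prod>i\<in>J. f i) (card J)" for J
    by (induction J rule: infinite_finite_induct) (auto simp: mult_monom)
  \<comment> \<open>In this form \<open>prod_add\<close> expands the product over the sets
    \<open>J\<close> of factors that contribute their linear term.\<close>
  have "(\<Prod>i\<in>I. [:1, f i:]) = (\<Prod>i\<in>I. monom (f i) 1 + 1)"
    by (intro prod.cong) (simp_all add: monom_altdef one_pCons)
  also have "\<dots> = (\<Sum>J\<in>Pow I. monom (\<Prod>i\<in>J. f i) (card J))"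
    by (simp add: prod_add[OF assms] monom)
  finally have "coeff (\<Prod>i\<in>I. [:1, f i:]) k = (\<Sum>J\<in>Pow I. if card J = k then \<Prod>i\<in>J. f i else 0)"
    by (simp add: coeff_sum)
  also have "\<dots> = (\<Sum>J\<in>{J \<in> Pow I. card J = k}. \<Prod>i\<in>J. f i)"
    using assms by (intro sum.inter_filter[symmetric]) simp
  finally show ?thesis by simp
qed

lemma elem_sym_eq_coeff: "elem_sym k v = coeff (\<Prod>i<dim_vec v. [:1, v $ i:]) k"
  by (simp add: elem_sym_def coeff_prod_linear atLeast0LessThan)

text \<open>The sorted roots of \<open>char_poly A\<close> form the same multiset as the diagonal
  \<open>f\<close> of a spectral decomposition, and the product of linear factors ignores the
  order.\<close>

lemma elem_sym_eigenvalue_vec: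
  assumes "A \<in> carrier_mat n n" "transpose_mat A = A"
  shows "elem_sym k (eigenvalue_vec A) = coeff (esp_poly A) k"
proof -
  obtain Q f where "orthogonal_mat_n n Q" and Af: "A = orthogonal_mat_n.conj_diag n Q f"
    using spectral_decomposition_conj_diag[OF assms] by blast
  then interpret orthogonal_mat_n n Q by simp
  define ys where "ys = sorted_list_of_multiset (proots (char_poly A))"
  have "proots (char_poly A) = (\<Sum>i<n. {#f i#})"
    unfolding Af char_poly_conj_diag by (subst proots_prod) auto
  also have "\<dots> = image_mset f (mset_set {..<n})"
    by (simp add: sum_unfold_sum_mset)
  finally have ys: "mset ys = image_mset f (mset_set {..<n})"
    by (simp add: ys_def)
  have "(\<Prod>i<length ys. [:1, ys ! i:]) = (\<Prod>y\<leftarrow>ys. [:1, y:])"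
    by (simp add: prod.list_conv_set_nth atLeast0LessThan)
  also have "\<dots> = prod_mset (image_mset (\<lambda>y. [:1, y:]) (mset ys))"
    by (simp flip: prod_mset_prod_list)
  also have "\<dots> = (\<Prod>i<n. [:1, f i:])"
    by (simp add: ys prod_unfold_prod_mset image_mset.compositionality comp_def)
  finally have "(\<Prod>i<length ys. [:1, ys ! i:]) = esp_poly A"
    unfolding Af esp_poly_conj_diag .
  then show ?thesis
    by (simp add: elem_sym_eq_coeff eigenvalue_vec_def vec_of_list_index flip: ys_def)
qed

lemma esp_poly_mat_diag: "esp_poly (mat_diag n f) = (\<Prod>i<n. [:1, f i:])"
proof (rule poly_ext)
  fix x
  have "1\<^sub>m n + x \<cdot>\<^sub>m mat_diag n f = mat_diag n (\<lambda>i. 1 + x * f i)"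
    by (rule eq_matI) (auto simp: mat_diag_def)
  then show "poly (esp_poly (mat_diag n f)) x = poly (\<Prod>i<n. [:1, f i:]) x"
    by (simp add: poly_esp_poly[OF mat_diag_dim] det_mat_diag poly_prod)
qed

theorem theorem1p3:
  fixes n k :: nat and A :: "real mat"
  assumes "k \<ge> 3" and "n \<ge> k"
    and "A \<in> carrier_mat n n"
    and "k_positive n k A"
  shows "mat_elem_sym k (diag_part A) \<ge> mat_elem_sym k A
    \<and> (mat_elem_sym k (diag_part A) = mat_elem_sym k A \<longleftrightarrow> diagonal_mat A)"
proof -
  note A = assms(3)
  have sym: "transpose_mat A = A"
    using assms(4) by (simp add: k_positive_def)
  have S_A: "elem_sym j (eigenvalue_vec A) = coeff (esp_poly A) j" for j
    by (rule elem_sym_eigenvalue_vec[OF A sym])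
  \<comment> \<open>The cone constrains degrees from 1 on; degree 0 is supplied by the empty
    product.\<close>
  have "elem_sym 0 v = 1" for v
    by (simp add: elem_sym_eq_coeff poly_0_coeff_0[symmetric] poly_prod)
  then have pos: "coeff (esp_poly A) j > 0" if "j \<le> k" for j
    using assms(4) that unfolding S_A[symmetric]
    by (cases "j = 0") (auto simp: k_positive_def Gamma_cone_def)
  have diag: "diag_part A = mat_diag n (\<lambda>i. A $$ (i, i))"
    using A by (simp add: diag_part_def)
  have "mat_elem_sym k A = coeff (esp_poly A) k"
    by (simp add: mat_elem_sym_def S_A)
  moreover have "mat_elem_sym k (diag_part A) = coeff (\<Prod>i<n. [:1, A $$ (i, i):]) k"
    unfolding mat_elem_sym_def diag
    by (subst elem_sym_eigenvalue_vec[OF mat_diag_dim transpose_mat_diag]) (simp add: esp_poly_mat_diag)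
  moreover have "diag_part A = A" if "diagonal_mat A"
    using that A by (intro eq_matI) (auto simp: diag mat_diag_def diagonal_mat_def)
  ultimately show ?thesis
    using esp_poly_le_diag[OF A sym real_rooted_1, of k] pos assms(1) by auto
qed

end
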